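(* Let $b,n\ge1$ be integers and fix a set partition $\mathcal P=\{P_1,\dots,P_t\}$ of $\{1,\dots,n\}$. Then $\mathrm{lel}(\pi)$ and $\mathrm{ones}(\pi)$ have a symmetric joint distribution over all $(1,b)$-parking functions $\pi\in\mathrm{PF}(1,b,n)$ whose reduced preference partition is $\mathcal P$; that is, for all integers $i,j$, the number of such $\pi$ with $(\mathrm{lel}(\pi),\mathrm{ones}(\pi))=(i,j)$ equals the number of such $\pi$ with $(\mathrm{lel}(\pi),\mathrm{ones}(\pi))=(j,i)$.
   Context: $\mathrm{PF}(1,b,n)$ is the set of $(1,b)$-parking functions of length $n$: sequences $\pi=(\pi_1,\dots,\pi_n)$ of positive integers whose weakly increasing rearrangement $\lambda_1\le\cdots\le\lambda_n$ satisfies $\lambda_i\le 1+(i-1)b$ for $1\le i\le n$. Put $\mathrm{lel}(\pi)=\#\{i:\pi_i=\pi_1\}$ and $\mathrm{ones}(\pi)=\#\{i:\pi_i=1\}$. Let $B_\pi(i)=\{j:\pi_j=i\}$. The preference partition of $\pi$ is the set partition of $\{1,\dots,n\}$ formed by the non-empty sets $B_\pi(i)$; the reduced preference partition is obtained from it by merging the blocks $B_\pi(1)$ and $B_\pi(\pi_1)$ into a single block (no change if $\pi_1=1$). *)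

theory Defs
  imports Main "HOL-Library.Disjoint_Sets"
begin

text \<open>
  A sequence \<open>\<pi> = (\<pi>\<^sub>1, \<dots>, \<pi>\<^sub>n)\<close> of positive integers is a list of naturals; positions are
  numbered from 1, so that \<open>\<pi>\<^sub>j\<close> is the list entry \<open>\<pi> ! (j - 1)\<close>.
\<close>

definition entry :: "nat list \<Rightarrow> nat \<Rightarrow> nat" where
  "entry \<pi> j = \<pi> ! (j - 1)"

definition PF :: "nat \<Rightarrow> nat \<Rightarrow> nat \<Rightarrow> nat list set" where
  "PF a b n = {\<pi>. length \<pi> = n \<and> (\<forall>i\<in>{1..n}. entry \<pi> i \<ge> 1) \<and>
     (\<forall>i\<in>{1..n}. entry (sort \<pi>) i \<le> a + (i - 1) * b)}"

definition lel :: "nat list \<Rightarrow> nat" where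
  "lel \<pi> = card {i \<in> {1..length \<pi>}. entry \<pi> i = entry \<pi> 1}"

definition ones :: "nat list \<Rightarrow> nat" where
  "ones \<pi> = card {i \<in> {1..length \<pi>}. entry \<pi> i = 1}"

definition pref_block :: "nat list \<Rightarrow> nat \<Rightarrow> nat set" where
  "pref_block \<pi> i = {j \<in> {1..length \<pi>}. entry \<pi> j = i}"

definition pref_partition :: "nat list \<Rightarrow> nat set set" where
  "pref_partition \<pi> = {pref_block \<pi> i | i. pref_block \<pi> i \<noteq> {}}"

text \<open>If \<open>\<pi>\<^sub>1 = 1\<close>, the block removed is the block inserted again, so nothing changes.\<close>

definition reduced_pref_partition :: "nat list \<Rightarrow> nat set set" where
  "reduced_pref_partition \<pi> =
     insert (pref_block \<pi> 1 \<union> pref_block \<pi> (entry \<pi> 1))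
       (pref_partition \<pi> - {pref_block \<pi> 1, pref_block \<pi> (entry \<pi> 1)})"

text \<open>Cardinalities of sets of parking functions are therefore genuine counts.\<close>

lemma finite_PF: "finite (PF a b n)"
proof (rule finite_subset)
  show "PF a b n \<subseteq> {xs. set xs \<subseteq> {..a + n * b} \<and> length xs = n}"
  proof
    fix \<pi> assume pi: "\<pi> \<in> PF a b n"
    have "x \<le> a + n * b" if "x \<in> set \<pi>" for x
    proof -
      have "x \<in> set (sort \<pi>)" using that by simp
      then obtain k where k: "k < length (sort \<pi>)" "sort \<pi> ! k = x"
        by (meson in_set_conv_nth)
      have "k < n" using k(1) pi by (simp add: PF_def)
      then have "Suc k \<in> {1..n}" by simp
      then have "entry (sort \<pi>) (Suc k) \<le> a + (Suc k - 1) * b"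
        using pi unfolding PF_def by blast
      then have "x \<le> a + k * b" using k(2) by (simp add: entry_def)
      also have "\<dots> \<le> a + n * b" using \<open>k < n\<close> by simp
      finally show ?thesis .
    qed
    then show "\<pi> \<in> {xs. set xs \<subseteq> {..a + n * b} \<and> length xs = n}"
      using pi by (auto simp: PF_def)
  qed
  show "finite {xs. set xs \<subseteq> {..a + n * b} \<and> length xs = n}"
    by (rule finite_lists_length_eq) simp
qed

end

theory Submission
  imports Defs "HOL-Library.FuncSet"
begin

text \<open>
  If \<open>\<pi>\<^sub>1 = 1\<close> the two statistics are equal, so for \<open>i \<noteq> j\<close> only sequences with \<open>\<pi>\<^sub>1 \<noteq> 1\<close> are
  counted. Let \<open>A\<close> be the block of \<open>\<P>\<close> that contains the position 1. Then \<open>A\<close> is the disjoint union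
  of \<open>L = B\<^sub>\<pi>(\<pi>\<^sub>1)\<close> and \<open>M = B\<^sub>\<pi>(1)\<close>, the two statistics are \<open>card L\<close> and \<open>card M\<close>, and the preference
  partition of \<open>\<pi>\<close> is \<open>\<P>\<close> with \<open>A\<close> replaced by \<open>L\<close> and \<open>M\<close> (\<open>PF_reduced_split_iff\<close>).

  The main point is that, for a fixed set partition \<open>Q\<close> of \<open>{1..n}\<close> and a block \<open>M\<close> of \<open>Q\<close>, the number
  of parking functions that have preference partition \<open>Q\<close> and take the value 1 exactly on \<open>M\<close> is
  \<open>card M / n\<close> times a number that depends only on \<open>n\<close>, \<open>b\<close> and \<open>card Q\<close> (\<open>card_PF_blocks\<close>).
  For this, read a sequence as a walk which at the value \<open>v\<close> goes up by \<open>b\<close> for every \<open>j\<close> with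
  \<open>\<pi>\<^sub>j = v\<close> and then down by 1. The sequence is a parking function iff the walk stays nonnegative
  on the values \<open>1, \<dots>, n b\<close> (\<open>PF_iff_ballot\<close>). If \<open>M\<close> takes the value 1, the other blocks are placed
  injectively on \<open>K = n b\<close> values, and the walk starts with a capital of \<open>r = b card M\<close>, which it loses
  during the \<open>K\<close> steps. Among the \<open>K\<close> cyclic rotations of any placement exactly \<open>r\<close> are
  admissible, by the cycle lemma (\<open>card_ballot_starts_of_periodic\<close>); hence the fraction
  \<open>r / K = card M / n\<close> of all injective placements is admissible.

  With \<open>card L = l\<close>, \<open>card M = m\<close> and \<open>l + m = card A\<close> there are \<open>(l + m - 1) choose (l - 1)\<close> choices of
  \<open>L\<close>, as it contains the position 1. The count for the pair \<open>(l, m)\<close> is thus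
  \<open>((l + m - 1) choose (l - 1)) m\<close> up to a factor independent of \<open>l\<close> and \<open>m\<close>, and this equals
  \<open>(l + m - 1)! / ((l - 1)! (m - 1)!)\<close>, which is symmetric in \<open>l\<close> and \<open>m\<close>.
\<close>

section \<open>The cycle lemma\<close>

text \<open>
  A form of the cycle lemma. The walk \<open>S x = x - (\<Sum>p<x. c p)\<close> goes up by at most 1 in each step and gains
  \<open>r\<close> in each period. A start \<open>x\<close> is counted iff the walk at time \<open>x + K\<close> exceeds all its \<open>K\<close> previous
  values, that is, iff the maximum \<open>W\<close> over a window of length \<open>K\<close> grows when the window moves from
  \<open>x\<close> to \<open>x + 1\<close>; it then grows by exactly 1. Over one period \<open>W\<close> grows by \<open>r\<close>, so \<open>r\<close> starts are
  counted.
\<close>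

lemma card_ballot_starts_of_periodic:
  fixes c :: "nat \<Rightarrow> nat"
  assumes period: "\<And>x. c (x + K) = c x"
    and total: "(\<Sum>x<K. c x) + r = K" and "r \<ge> 1"
  shows "card {x \<in> {..<K}. \<forall>t<K. t < r + (\<Sum>p<t. c (x + p))} = r"
proof -
  define S where "S x = int x - (\<Sum>p<x. int (c p))" for x
  define W where "W x = Max ((\<lambda>t. S (x + t)) ` {..<K})" for x
  have K: "K \<ge> 1"
    using assms by simp
  have S_add: "S (x + t) = S x + int t - int (\<Sum>p<t. c (x + p))" for x t
    by (induction t) (simp_all add: S_def)
  have S_period: "S (x + K) = S x + int r" for x
  proof (induction x)
    case 0
    have "int (\<Sum>x<K. c x) + int r = int K"
      using total by (metis of_nat_add)
    then show ?case
      by (simp add: S_def)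
  next
    case (Suc x)
    then show ?case
      using period[of x] by (simp add: S_def)
  qed
  have good_iff: "(\<forall>t<K. t < r + (\<Sum>p<t. c (x + p))) \<longleftrightarrow> S (x + K) > W x" for x
  proof -
    have "(\<forall>t<K. t < r + (\<Sum>p<t. c (x + p))) \<longleftrightarrow> (\<forall>t<K. S (x + t) < S (x + K))"
    proof -
      have "t < r + (\<Sum>p<t. c (x + p)) \<longleftrightarrow> S (x + t) < S (x + K)" for t
        unfolding S_period[of x] S_add[of x t] by linarith
      then show ?thesis
        by simp
    qed
    also have "\<dots> \<longleftrightarrow> W x < S (x + K)"
      using K unfolding W_def by (subst Max_less_iff) (auto simp: lessThan_empty_iff)
    finally show ?thesis .
  qed
  have W_step: "W (Suc x) - W x = (if S (x + K) > W x then 1 else 0)" for x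
  proof -
    obtain L where L: "K = Suc L"
      using K by (cases K) auto
    have img: "(\<lambda>t. S (Suc x + t)) ` {..<K} \<union> {S x} = insert (S (x + K)) ((\<lambda>t. S (x + t)) ` {..<K})"
      (is "?A \<union> _ = insert _ ?B")
    proof -
      have "?A \<union> {S x} = (\<lambda>t. S (x + t)) ` insert 0 (Suc ` {..<K})"
        by (simp add: image_image)
      also have "insert 0 (Suc ` {..<K}) = insert K {..<K}"
        by (metis lessThan_Suc lessThan_Suc_eq_insert_0)
      finally show ?thesis
        by simp
    qed
    have ne: "?A \<noteq> {}" "?B \<noteq> {}" "finite ?A" "finite ?B"
      using K by (auto simp: lessThan_empty_iff)
    have mem: "S (x + K) \<in> ?A" "S (x + L) \<in> ?B"
      unfolding L by (auto intro: image_eqI[of _ _ L])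
    \<comment> \<open>The value S x that leaves the window is not its maximum, because S (x + K) = S x + r enters.\<close>
    have "S x \<le> W (Suc x)"
      unfolding W_def using Max_ge[OF ne(3) mem(1)] S_period[of x] by simp
    then have "W (Suc x) = Max (?A \<union> {S x})"
      unfolding W_def using ne by (simp add: Max_insert2 max_def)
    also have "\<dots> = max (S (x + K)) (W x)"
      unfolding img W_def using ne by simp
    finally have "W (Suc x) = max (S (x + K)) (W x)" .
    moreover have "S (x + K) \<le> S (x + L) + 1"
      unfolding L by (simp add: S_def)
    moreover have "S (x + L) \<le> W x"
      unfolding W_def using Max_ge[OF ne(4) mem(2)] by simp
    ultimately show ?thesis
      by auto
  qed
  have W_period: "W (x + K) = W x + int r" for x
  proof -
    have "W (x + K) = Max ((\<lambda>t. S (x + t) + int r) ` {..<K})"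
      unfolding W_def using S_period by (metis (no_types, lifting) add.assoc add.commute)
    also have "\<dots> = W x + int r"
      unfolding W_def using K by (subst Max_add_commute) (auto simp: lessThan_empty_iff)
    finally show ?thesis .
  qed
  have "int (card {x \<in> {..<K}. S (x + K) > W x}) = (\<Sum>x<K. W (Suc x) - W x)"
    unfolding W_step by (simp add: sum.If_cases Int_def)
  also have "\<dots> = int r"
    using W_period[of 0] by (simp add: sum_lessThan_telescope)
  finally show ?thesis
    unfolding good_iff by simp
qed

text \<open>
  Rotating the target permutes the injections, and the cycle lemma says that every injection is turned
  into an admissible one by exactly \<open>r\<close> of the \<open>K\<close> rotations. Counting the pairs of a rotation and an
  injection in two ways gives the identity.
\<close>

lemma card_ballot_injections:
  fixes w :: "'a \<Rightarrow> nat" and K r :: nat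
  assumes I: "finite I" and total: "sum w I + r = K" and "r \<ge> 1"
  shows "K * card {h \<in> {h \<in> I \<rightarrow>\<^sub>E {..<K}. inj_on h I}. \<forall>t<K. t < r + (\<Sum>B | B \<in> I \<and> h B < t. w B)}
       = r * card {h \<in> I \<rightarrow>\<^sub>E {..<K}. inj_on h I}"
proof -
  define J where "J = {h \<in> I \<rightarrow>\<^sub>E {..<K}. inj_on h I}"
  define ballot where "ballot h \<longleftrightarrow> (\<forall>t<K. t < r + (\<Sum>B | B \<in> I \<and> h B < t. w B))" for h
  \<comment> \<open>Rotation by -x, written with K - x to stay within the natural numbers.\<close>
  define rot where "rot x h = (\<lambda>B\<in>I. (h B + (K - x)) mod K)" for x and h :: "'a \<Rightarrow> nat"
  have K: "K > 0"
    using assms by simp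
  have "J \<subseteq> I \<rightarrow>\<^sub>E {..<K}"
    by (auto simp: J_def)
  then have finJ: "finite J"
    by (rule finite_subset) (use I in \<open>simp add: finite_PiE\<close>)
  have rot_eq_iff: "(a + (K - x)) mod K = p \<longleftrightarrow> a = (x + p) mod K"
    if "x < K" "p < K" "a < K" for a x p
  proof
    assume "(a + (K - x)) mod K = p"
    then have "(x + p) mod K = (x + (a + (K - x))) mod K"
      by (metis mod_add_right_eq)
    also have "x + (a + (K - x)) = a + K"
      using that by simp
    finally show "a = (x + p) mod K"
      using that by simp
  next
    assume "a = (x + p) mod K"
    then have "(a + (K - x)) mod K = (x + p + (K - x)) mod K"
      by (metis mod_add_left_eq)
    also have "x + p + (K - x) = p + K"
      using that by simp
    finally show "(a + (K - x)) mod K = p"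
      using that by simp
  qed
  have rot_J: "bij_betw (rot x) J J" if x: "x < K" for x
  proof -
    have h_lt: "h B < K" if "h \<in> J" "B \<in> I" for h B
      using that by (auto simp: J_def PiE_iff)
    have rot_lt: "(a + (K - x)) mod K < K" for a
      using K by simp
    have cancel: "a = a'" if "a < K" "a' < K" "(a + (K - x)) mod K = (a' + (K - x)) mod K" for a a'
      using rot_eq_iff[OF x rot_lt, of a a'] rot_eq_iff[OF x rot_lt, of a' a'] that by simp
    have into: "rot x ` J \<subseteq> J"
    proof (rule image_subsetI)
      fix h assume h: "h \<in> J"
      then have "inj_on (rot x h) I"
        unfolding rot_def inj_on_def using cancel h_lt by (auto simp: J_def inj_on_def)
      then show "rot x h \<in> J"
        using K by (auto simp: J_def rot_def)
    qed
    moreover have "inj_on (rot x) J"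
    proof (rule inj_onI)
      fix h h' assume hh: "h \<in> J" "h' \<in> J" "rot x h = rot x h'"
      have "h B = h' B" for B
      proof (cases "B \<in> I")
        case True
        then show ?thesis
          using cancel[OF h_lt[OF hh(1) True] h_lt[OF hh(2) True]] fun_cong[OF hh(3), of B]
          by (simp add: rot_def)
      next
        case False
        then show ?thesis
          using hh by (auto simp: J_def PiE_iff extensional_def)
      qed
      then show "h = h'"
        by auto
    qed
    ultimately show ?thesis
      using endo_inj_surj[OF finJ into] by (simp add: bij_betw_def)
  qed
  have starts: "card {x \<in> {..<K}. ballot (rot x h)} = r" if h: "h \<in> J" for h
  proof -
    define c where "c x = (\<Sum>B | B \<in> I \<and> h B = x mod K. w B)" for x
    have hK: "h ` I \<subseteq> {..<K}"
      using h by (auto simp: J_def)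
    have "(\<Sum>x<K. c x) = (\<Sum>x<K. \<Sum>B | B \<in> I \<and> h B = x. w B)"
      by (simp add: c_def)
    also have "\<dots> = sum w I"
      using I hK by (intro sum.group) auto
    finally have c_total: "(\<Sum>x<K. c x) + r = K"
      using total by simp
    have partial: "(\<Sum>p<t. c (x + p)) = (\<Sum>B | B \<in> I \<and> rot x h B < t. w B)"
      if x: "x < K" and t: "t < K" for x t
    proof -
      have "(\<Sum>p<t. c (x + p)) = (\<Sum>p<t. \<Sum>B | B \<in> {B \<in> I. rot x h B < t} \<and> rot x h B = p. w B)"
        unfolding c_def
      proof (intro sum.cong refl)
        fix p assume "p \<in> {..<t}"
        then show "{B \<in> I. h B = (x + p) mod K} = {B. B \<in> {B \<in> I. rot x h B < t} \<and> rot x h B = p}"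
          using rot_eq_iff[OF x, of p] t hK by (auto simp: rot_def image_subset_iff)
      qed
      also have "\<dots> = (\<Sum>B | B \<in> I \<and> rot x h B < t. w B)"
        using I by (intro sum.group) auto
      finally show ?thesis .
    qed
    have "{x \<in> {..<K}. ballot (rot x h)} = {x \<in> {..<K}. \<forall>t<K. t < r + (\<Sum>p<t. c (x + p))}"
      unfolding ballot_def using partial by auto
    also have "card \<dots> = r"
      using c_total \<open>r \<ge> 1\<close> by (intro card_ballot_starts_of_periodic) (auto simp: c_def)
    finally show ?thesis .
  qed
  have "card {h \<in> J. ballot (rot x h)} = card {h \<in> J. ballot h}" if "x < K" for x
  proof (rule bij_betw_same_card)
    show "bij_betw (rot x) {h \<in> J. ballot (rot x h)} {h \<in> J. ballot h}"
      using rot_J[OF that] by (fastforce simp: bij_betw_def inj_on_def)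
  qed
  then have "K * card {h \<in> J. ballot h} = (\<Sum>x<K. card {h \<in> J. ballot (rot x h)})"
    by simp
  also have "\<dots> = r * card J"
    using finJ starts by (intro sum_multicount) auto
  finally show ?thesis
    unfolding J_def ballot_def .
qed

section \<open>Parking functions as ballot sequences\<close>

text \<open>
  In a sorted list the elements up to a threshold form an initial segment.
\<close>

lemma sorted_nth_le_iff:
  fixes xs :: "'a::linorder list"
  assumes "sorted xs" "k < length xs"
  shows "xs ! k \<le> x \<longleftrightarrow> k < length (filter (\<lambda>y. y \<le> x) xs)"
  using assms
proof (induction xs arbitrary: k)
  case (Cons a xs)
  show ?case
  proof (cases "a \<le> x")
    case True
    then show ?thesis
      using Cons by (cases k) auto
  next
    case False
    then have "\<forall>y\<in>set (a # xs). \<not> y \<le> x"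
      using Cons.prems by auto
    then have "filter (\<lambda>y. y \<le> x) (a # xs) = []" and "\<not> (a # xs) ! k \<le> x"
      using nth_mem[OF Cons.prems(2)] by (auto simp: filter_empty_conv)
    then show ?thesis
      by (metis list.size(3) not_less_zero)
  qed
qed simp

lemma card_entry: "card {j \<in> {1..length \<pi>}. P (entry \<pi> j)} = length (filter P \<pi>)"
proof -
  have "{j \<in> {1..length \<pi>}. P (entry \<pi> j)} = Suc ` {k. k < length \<pi> \<and> P (\<pi> ! k)}"
  proof (intro set_eqI iffI)
    fix j assume "j \<in> {j \<in> {1..length \<pi>}. P (entry \<pi> j)}"
    then show "j \<in> Suc ` {k. k < length \<pi> \<and> P (\<pi> ! k)}"
      by (intro image_eqI[of _ _ "j - 1"]) (auto simp: entry_def)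
  qed (auto simp: entry_def)
  then show ?thesis
    by (simp add: card_image length_filter_conv_card)
qed

lemma entry_sort_le_iff:
  assumes "i \<in> {1..length \<pi>}"
  shows "entry (sort \<pi>) i \<le> x \<longleftrightarrow> i \<le> card {j \<in> {1..length \<pi>}. entry \<pi> j \<le> x}"
proof -
  have "length (filter (\<lambda>y. y \<le> x) (sort \<pi>)) = length (filter (\<lambda>y. y \<le> x) \<pi>)"
    by (simp add: filter_sort)
  moreover have "i - 1 < m \<longleftrightarrow> i \<le> m" for m
    using assms by auto
  ultimately show ?thesis
    using assms sorted_nth_le_iff[of "sort \<pi>" "i - 1" x] card_entry[of \<pi> "\<lambda>y. y \<le> x"]
    by (simp add: entry_def)
qed

text \<open>
  As a condition on the counting function of the entries, the bound on the \<open>i\<close>-th smallest entry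
  says that at least \<open>i\<close> entries are at most \<open>1 + (i - 1) b\<close>. Between \<open>v = 1 + (i - 1) b\<close> and
  \<open>v = i b\<close> the required lower bound \<open>v / b\<close>, rounded up, stays equal to \<open>i\<close>, so it suffices to ask
  for it at the left end of each of these intervals.
\<close>

lemma PF_iff_ballot:
  assumes "b \<ge> 1" "length \<pi> = n" and pos: "\<forall>i\<in>{1..n}. entry \<pi> i \<ge> 1"
  shows "\<pi> \<in> PF 1 b n \<longleftrightarrow> (\<forall>v\<in>{1..n * b}. v \<le> b * card {j \<in> {1..n}. entry \<pi> j \<le> v})"
    (is "_ \<longleftrightarrow> (\<forall>v\<in>_. v \<le> b * ?c v)")
proof -
  have "\<pi> \<in> PF 1 b n \<longleftrightarrow> (\<forall>i\<in>{1..n}. i \<le> ?c (1 + (i - 1) * b))"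
    using assms entry_sort_le_iff[of _ \<pi>] by (simp add: PF_def)
  also have "\<dots> \<longleftrightarrow> (\<forall>v\<in>{1..n * b}. v \<le> b * ?c v)"
  proof (intro iffI ballI)
    fix v assume all: "\<forall>i\<in>{1..n}. i \<le> ?c (1 + (i - 1) * b)" and v: "v \<in> {1..n * b}"
    define i where "i = (v - 1) div b"
    have "v - 1 < n * b"
      using v by auto
    then have "i < n"
      using assms by (simp add: i_def less_mult_imp_div_less)
    then have "Suc i \<in> {1..n}"
      by simp
    then have "Suc i \<le> ?c (1 + i * b)"
      using all by force
    also have "\<dots> \<le> ?c v"
    proof (intro card_mono)
      have "1 + i * b \<le> v"
        using v div_times_less_eq_dividend[of "v - 1" b] unfolding i_def atLeastAtMost_iff by linarith
      then show "{j \<in> {1..n}. entry \<pi> j \<le> 1 + i * b} \<subseteq> {j \<in> {1..n}. entry \<pi> j \<le> v}"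
        by auto
    qed simp
    finally have "b * Suc i \<le> b * ?c v"
      by (rule mult_le_mono2)
    moreover have "v \<le> b * Suc i"
      using v assms dividend_less_times_div[of b "v - 1"] by (auto simp: i_def)
    ultimately show "v \<le> b * ?c v"
      by linarith
  next
    fix i assume all: "\<forall>v\<in>{1..n * b}. v \<le> b * ?c v" and i: "i \<in> {1..n}"
    let ?v = "1 + (i - 1) * b"
    have "?v \<le> i * b"
      using i assms by (cases i) auto
    also have "\<dots> \<le> n * b"
      using i by simp
    finally have "?v \<le> b * ?c ?v"
      using all by simp
    then have "(i - 1) * b < ?c ?v * b"
      unfolding mult.commute[of b "?c ?v"] by linarith
    then show "i \<le> ?c ?v"
      using mult_less_cancel2[of "i - 1" b "?c ?v"] by linarith
  qed
  finally show ?thesis .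
qed

lemma entry_map_upt: "j \<in> {1..n} \<Longrightarrow> entry (map f [1..<Suc n]) j = f j"
  by (auto simp: entry_def nth_append simp del: upt_Suc)

lemma list_eq_iff_entry:
  assumes "length \<pi> = n" "length \<sigma> = n"
  shows "\<pi> = \<sigma> \<longleftrightarrow> (\<forall>j\<in>{1..n}. entry \<pi> j = entry \<sigma> j)"
proof
  assume eq: "\<forall>j\<in>{1..n}. entry \<pi> j = entry \<sigma> j"
  show "\<pi> = \<sigma>"
  proof (rule nth_equalityI)
    fix k assume "k < length \<pi>"
    then show "\<pi> ! k = \<sigma> ! k"
      using bspec[OF eq, of "Suc k"] assms by (simp add: entry_def)
  qed (simp add: assms)
qed simp

text \<open>
  The ballot condition at \<open>v = n b\<close> already forces all \<open>n\<close> entries to be at most \<open>n b\<close>, although the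
  placements counted by the cycle lemma may use the value \<open>n b + 1\<close> as well.
\<close>

lemma PF_entry_le:
  assumes "b \<ge> 1" "\<pi> \<in> PF 1 b n" "j \<in> {1..n}"
  shows "entry \<pi> j \<le> n * b"
proof -
  have "n * b \<in> {1..n * b}"
    using assms by auto
  moreover have "length \<pi> = n" "\<forall>i\<in>{1..n}. entry \<pi> i \<ge> 1"
    using assms by (auto simp: PF_def)
  ultimately have "n * b \<le> b * card {j \<in> {1..n}. entry \<pi> j \<le> n * b}"
    using PF_iff_ballot assms by blast
  then have "card {1..n} \<le> card {j \<in> {1..n}. entry \<pi> j \<le> n * b}"
    using assms by (simp add: mult.commute)
  then have "{j \<in> {1..n}. entry \<pi> j \<le> n * b} = {1..n}"
    by (intro card_seteq) auto
  then have "j \<in> {j \<in> {1..n}. entry \<pi> j \<le> n * b}"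
    using assms(3) by (simp only:)
  then show ?thesis
    by simp
qed

section \<open>Parking functions with a given preference partition\<close>

text \<open>
  A parking function with preference partition \<open>Q\<close> and value 1 on \<open>M\<close> is the same as an admissible
  injection from the other blocks to \<open>{0..<n b}\<close>, a block placed at \<open>t\<close> receiving the value \<open>t + 2\<close>.
  The fraction of admissible injections is \<open>b card M / (n b)\<close>.
\<close>

lemma card_PF_blocks:
  assumes b: "b \<ge> 1" and Q: "partition_on {1..n} Q" and M: "M \<in> Q"
  shows "n * card {\<pi> \<in> PF 1 b n. pref_partition \<pi> = Q \<and> pref_block \<pi> 1 = M}
       = card M * (\<Prod>k=0..<card Q - 1. n * b - k)"
proof -
  define I where "I = Q - {M}"
  define J where "J = {h \<in> I \<rightarrow>\<^sub>E {..<n * b}. inj_on h I}"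
  define G where "G = {h \<in> J. \<forall>t<n * b. t < b * card M + (\<Sum>B | B \<in> I \<and> h B < t. b * card B)}"
  define Y where "Y = {\<pi> \<in> PF 1 b n. pref_partition \<pi> = Q \<and> pref_block \<pi> 1 = M}"
  have union: "\<Union>Q = {1..n}" and disj: "disjoint Q" and ne: "{} \<notin> Q"
    using Q by (auto simp: partition_on_def)
  have finB: "finite B" if "B \<in> Q" for B
    by (rule finite_subset[OF _ finite_atLeastAtMost[of 1 n]]) (use that union in blast)
  have finQ: "finite Q"
    using union by (metis finite_UnionD finite_atLeastAtMost)
  then have finI: "finite I" and QI: "Q = insert M I" "M \<notin> I"
    using M by (auto simp: I_def)
  have card_Union: "card (\<Union>C) = sum card C" if "C \<subseteq> Q" for C
    using that disj finB by (intro card_Union_disjoint) (auto simp: disjoint_def pairwise_def disjnt_def)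
  have "card M > 0"
    using M ne finB by (metis card_gt_0_iff)
  have "sum card Q = n"
    using card_Union[of Q] union by simp
  then have "card M + sum card I = n"
    using QI finI by simp
  then have total: "(\<Sum>B\<in>I. b * card B) + b * card M = n * b"
    by (metis add.commute distrib_left mult.commute sum_distrib_left)

  have "\<forall>j\<in>{1..n}. \<exists>B. B \<in> Q \<and> j \<in> B"
    using union by auto
  then obtain blk where blk: "blk j \<in> Q" "j \<in> blk j" if "j \<in> {1..n}" for j
    by metis
  have blk_eq: "blk j = B" "j \<in> {1..n}" if "j \<in> B" "B \<in> Q" for j B
  proof -
    show j: "j \<in> {1..n}"
      using that union by auto
    show "blk j = B"
      using blk[OF j] that disj by (auto simp: disjoint_def)
  qed

  \<comment> \<open>The sequence seq h gives every position the value of its block; the shift by 2 skips the value 1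
      reserved for M.\<close>
  define val where "val h B = (if B = M then 1 else h B + 2)" for h :: "nat set \<Rightarrow> nat" and B
  define seq where "seq h = map (\<lambda>j. val h (blk j)) [1..<Suc n]" for h
  have length_seq: "length (seq h) = n" for h
    by (simp add: seq_def)
  have entry_seq: "entry (seq h) j = val h (blk j)" if "j \<in> {1..n}" for h j
    using that unfolding seq_def by (rule entry_map_upt)
  have val_inj: "val h B = val h C \<longleftrightarrow> B = C" if "h \<in> J" "B \<in> Q" "C \<in> Q" for h B C
    using that by (auto simp: val_def J_def I_def inj_on_def)
  have block_seq: "pref_block (seq h) (val h B) = B" if "h \<in> J" "B \<in> Q" for h B
    using that blk blk_eq val_inj
    by (auto simp: pref_block_def length_seq entry_seq simp del: atLeastAtMost_iff)
  have partition_seq: "pref_partition (seq h) = Q" if h: "h \<in> J" for h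
  proof (intro set_eqI iffI)
    fix B assume "B \<in> pref_partition (seq h)"
    then obtain v where v: "B = pref_block (seq h) v" "B \<noteq> {}"
      by (auto simp: pref_partition_def)
    then obtain j where "j \<in> {1..n}" "v = val h (blk j)"
      by (auto simp: pref_block_def length_seq entry_seq)
    then show "B \<in> Q"
      using v block_seq[OF h] blk by simp
  next
    fix B assume "B \<in> Q"
    then show "B \<in> pref_partition (seq h)"
      using block_seq[OF h \<open>B \<in> Q\<close>] ne unfolding pref_partition_def by auto
  qed
  have seq_PF: "seq h \<in> PF 1 b n \<longleftrightarrow> h \<in> G" if h: "h \<in> J" for h
  proof -
    \<comment> \<open>The ballot condition for seq h at v = t + 1 is the condition at t in the definition of G.\<close>
    have count: "b * card {j \<in> {1..n}. entry (seq h) j \<le> Suc t}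
        = b * card M + (\<Sum>B | B \<in> I \<and> h B < t. b * card B)" for t
    proof -
      have "{j \<in> {1..n}. entry (seq h) j \<le> Suc t} = \<Union>(insert M {B \<in> I. h B < t})"
      proof (intro set_eqI iffI)
        fix j assume "j \<in> {j \<in> {1..n}. entry (seq h) j \<le> Suc t}"
        then have "j \<in> {1..n}" "val h (blk j) \<le> Suc t"
          using entry_seq by auto
        then show "j \<in> \<Union>(insert M {B \<in> I. h B < t})"
          using blk[of j] by (auto simp: val_def I_def split: if_splits)
      next
        fix j assume "j \<in> \<Union>(insert M {B \<in> I. h B < t})"
        then obtain B where "j \<in> B" "B = M \<or> B \<in> I \<and> h B < t"
          by auto
        then have "j \<in> {1..n}" "val h (blk j) \<le> Suc t"
          using blk_eq[of j B] M by (auto simp: I_def val_def)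
        then show "j \<in> {j \<in> {1..n}. entry (seq h) j \<le> Suc t}"
          using entry_seq by auto
      qed
      also have "card \<dots> = card M + (\<Sum>B | B \<in> I \<and> h B < t. card B)"
        using QI finI by (subst card_Union) auto
      finally show ?thesis
        by (simp add: distrib_left sum_distrib_left)
    qed
    have pos: "\<forall>i\<in>{1..n}. entry (seq h) i \<ge> 1"
      using entry_seq by (simp add: val_def)
    have "seq h \<in> PF 1 b n \<longleftrightarrow>
        (\<forall>t<n * b. Suc t \<le> b * card {j \<in> {1..n}. entry (seq h) j \<le> Suc t})"
      unfolding PF_iff_ballot[OF b length_seq pos]
    proof (intro iffI ballI allI impI)
      fix v assume "\<forall>t<n * b. Suc t \<le> b * card {j \<in> {1..n}. entry (seq h) j \<le> Suc t}"
        and "v \<in> {1..n * b}"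
      then show "v \<le> b * card {j \<in> {1..n}. entry (seq h) j \<le> v}"
        by (cases v) auto
    qed auto
    then show ?thesis
      unfolding count using h by (simp add: G_def Suc_le_eq)
  qed

  have "bij_betw seq G Y"
  proof (rule bij_betwI')
    fix h h' assume "h \<in> G" "h' \<in> G"
    then have hJ: "h \<in> J" "h' \<in> J"
      by (auto simp: G_def)
    show "seq h = seq h' \<longleftrightarrow> h = h'"
    proof
      assume eq: "seq h = seq h'"
      show "h = h'"
      proof
        fix B show "h B = h' B"
        proof (cases "B \<in> I")
          case True
          then obtain j where j: "j \<in> B" "B \<in> Q"
            using ne by (auto simp: I_def) (metis all_not_in_conv)
          then show ?thesis
            using True QI entry_seq[of j h] entry_seq[of j h'] blk_eq[OF j] eq
            by (auto simp: val_def split: if_splits)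
        next
          case False
          then show ?thesis
            using hJ by (auto simp: J_def PiE_iff extensional_def)
        qed
      qed
    qed simp
  next
    fix h assume "h \<in> G"
    then have h: "h \<in> J" "seq h \<in> PF 1 b n"
      using seq_PF by (auto simp: G_def)
    then show "seq h \<in> Y"
      using partition_seq block_seq[of h M] M by (simp add: Y_def val_def)
  next
    fix \<pi> assume "\<pi> \<in> Y"
    then have \<pi>: "\<pi> \<in> PF 1 b n" "length \<pi> = n" "pref_partition \<pi> = Q" "pref_block \<pi> 1 = M"
      and pos: "\<And>j. j \<in> {1..n} \<Longrightarrow> entry \<pi> j \<ge> 1"
      by (auto simp: Y_def PF_def)
    have "\<forall>B\<in>Q. \<exists>v. B = pref_block \<pi> v"
      unfolding \<pi>(3)[symmetric] by (auto simp: pref_partition_def)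
    then obtain v where v: "pref_block \<pi> (v B) = B" if "B \<in> Q" for B
      by metis
    have entry_v: "entry \<pi> j = v (blk j)" if j: "j \<in> {1..n}" for j
      using v[OF blk(1)[OF j]] blk(2)[OF j] by (auto simp: pref_block_def)
    have v_M: "v M = 1"
    proof -
      obtain j where "j \<in> M"
        using M ne by (metis all_not_in_conv)
      then have "j \<in> pref_block \<pi> (v M)" "j \<in> pref_block \<pi> 1"
        using v[OF M] \<pi>(4) by simp_all
      then show ?thesis
        by (simp add: pref_block_def)
    qed
    have v_I: "v B \<ge> 2" "v B \<le> n * b" if B: "B \<in> I" for B
    proof -
      obtain j where j: "j \<in> B" "B \<in> Q"
        using B ne by (auto simp: I_def) (metis all_not_in_conv)
      then have "entry \<pi> j = v B" "j \<in> {1..n}"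
        using entry_v blk_eq[OF j] by auto
      then show "v B \<le> n * b"
        using PF_entry_le[OF b \<pi>(1)] by metis
      have "v B \<noteq> 1"
        using v[OF j(2)] \<pi>(4) B QI(2) by metis
      then show "v B \<ge> 2"
        using pos[of j] \<open>entry \<pi> j = v B\<close> \<open>j \<in> {1..n}\<close> by simp
    qed
    define h where "h = (\<lambda>B\<in>I. v B - 2)"
    have val_h: "val h B = v B" if "B \<in> Q" for B
    proof (cases "B = M")
      case False
      then have "B \<in> I"
        using that QI by simp
      then show ?thesis
        using v_I(1)[of B] False by (simp add: val_def h_def)
    qed (simp add: val_def v_M)
    have "inj_on h I"
    proof (rule inj_onI)
      fix B C assume BC: "B \<in> I" "C \<in> I" "h B = h C"
      then have "v B = v C"
        using v_I(1)[of B] v_I(1)[of C] by (simp add: h_def)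
      then show "B = C"
        using v[of B] v[of C] BC QI(1) by (metis insertCI)
    qed
    moreover have "h \<in> I \<rightarrow>\<^sub>E {..<n * b}"
      using v_I by (fastforce simp: h_def)
    ultimately have h: "h \<in> J"
      by (simp add: J_def)
    have "\<pi> = seq h"
      using list_eq_iff_entry[OF \<pi>(2) length_seq] entry_v entry_seq val_h blk(1) by simp
    then show "\<exists>h\<in>G. \<pi> = seq h"
      using seq_PF[OF h] \<pi>(1) by auto
  qed
  then have "card Y = card G"
    by (metis bij_betw_same_card)
  moreover have "n * b * card G = b * card M * card J"
    unfolding G_def J_def
    using finI total b \<open>card M > 0\<close> by (intro card_ballot_injections) auto
  ultimately have "n * card Y = card M * card J"
    using b by simp
  moreover have "card J = (\<Prod>k=0..<card Q - 1. n * b - k)"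
    using card_inj_on_subset_funcset[of I "{..<n * b}" I] finI QI by (simp add: J_def)
  ultimately show ?thesis
    by (simp add: Y_def)
qed

section \<open>Undoing the reduction of the preference partition\<close>

lemma entry_of_mem_pref_block: "j \<in> pref_block \<pi> v \<Longrightarrow> entry \<pi> j = v"
  by (simp add: pref_block_def)

lemma pref_block_disjoint: "v \<noteq> v' \<Longrightarrow> pref_block \<pi> v \<inter> pref_block \<pi> v' = {}"
  by (auto simp: pref_block_def)

lemma PF_ones_block_nonempty:
  assumes "n \<ge> 1" "\<pi> \<in> PF 1 b n"
  shows "pref_block \<pi> 1 \<noteq> {}"
proof -
  have len: "length \<pi> = n" and pos: "\<forall>i\<in>{1..n}. entry \<pi> i \<ge> 1"
    and sorted: "\<forall>i\<in>{1..n}. entry (sort \<pi>) i \<le> 1 + (i - 1) * b"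
    using assms by (auto simp: PF_def)
  have "entry (sort \<pi>) 1 \<le> 1"
    using bspec[OF sorted, of 1] assms by simp
  then have "1 \<le> card {j \<in> {1..n}. entry \<pi> j \<le> 1}"
    using entry_sort_le_iff[of 1 \<pi> 1] len assms by simp
  then have "{j \<in> {1..n}. entry \<pi> j \<le> 1} \<noteq> {}"
    by (metis card.empty not_one_le_zero)
  then obtain j where "j \<in> {1..n}" "entry \<pi> j \<le> 1"
    by auto
  then have "j \<in> pref_block \<pi> 1"
    using bspec[OF pos, of j] len by (auto simp: pref_block_def)
  then show ?thesis
    by auto
qed

text \<open>
  Merging \<open>B\<^sub>\<pi>(1)\<close> and \<open>B\<^sub>\<pi>(\<pi>\<^sub>1)\<close> is undone by prescribing which part of the block of position 1 carries
  the value \<open>\<pi>\<^sub>1\<close>: for \<open>\<pi>\<^sub>1 \<noteq> 1\<close>, fixing the reduced partition together with that part \<open>L\<close> amounts to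
  fixing the unreduced partition together with the block of ones. The part \<open>L\<close> is proper since a
  parking function contains an entry 1.
\<close>

lemma PF_reduced_split_iff:
  assumes n: "n \<ge> 1" and \<P>: "partition_on {1..n} \<P>" and A: "A \<in> \<P>" "1 \<in> A"
    and \<pi>: "\<pi> \<in> PF 1 b n"
  shows "reduced_pref_partition \<pi> = \<P> \<and> entry \<pi> 1 \<noteq> 1 \<and> pref_block \<pi> (entry \<pi> 1) = L \<longleftrightarrow>
     1 \<in> L \<and> L \<subset> A \<and> pref_partition \<pi> = insert L (insert (A - L) (\<P> - {A})) \<and> pref_block \<pi> 1 = A - L"
    (is "?lhs \<longleftrightarrow> ?rhs")
proof
  have disj: "\<And>B C. B \<in> \<P> \<Longrightarrow> C \<in> \<P> \<Longrightarrow> B \<noteq> C \<Longrightarrow> B \<inter> C = {}"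
    using \<P> by (auto simp: partition_on_def disjoint_def)
  let ?M = "pref_block \<pi> 1" and ?L = "pref_block \<pi> (entry \<pi> 1)"
  have len: "length \<pi> = n"
    using \<pi> by (simp add: PF_def)
  have M: "?M \<noteq> {}"
    using PF_ones_block_nonempty[OF n \<pi>] .
  have one: "1 \<in> ?L"
    using n len by (simp add: pref_block_def)
  {
    assume lhs: ?lhs
    then have L: "?L = L" and not_one: "entry \<pi> 1 \<noteq> 1" and "reduced_pref_partition \<pi> = \<P>"
      by blast+
    then have red: "insert (?M \<union> L) (pref_partition \<pi> - {?M, L}) = \<P>"
      unfolding reduced_pref_partition_def L by blast
    then have "?M \<union> L \<in> \<P>"
      by auto
    moreover have "1 \<in> (?M \<union> L) \<inter> A"
      using A one unfolding L by simp
    ultimately have A_eq: "?M \<union> L = A"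
      using disj[of "?M \<union> L" A] A(1) by (metis empty_iff)
    have disj_LM: "?M \<inter> L = {}"
      using pref_block_disjoint[OF not_one, of \<pi>] unfolding L by (simp add: Int_commute)
    have in_pp: "?M \<in> pref_partition \<pi>" "L \<in> pref_partition \<pi>"
      using M one unfolding L[symmetric] by (auto simp: pref_partition_def)
    have "A \<notin> pref_partition \<pi>"
    proof
      assume "A \<in> pref_partition \<pi>"
      then obtain v where "A = pref_block \<pi> v"
        by (auto simp: pref_partition_def)
      then have "1 \<in> pref_block \<pi> v" "?M \<subseteq> pref_block \<pi> v"
        using A(2) A_eq by auto
      then have "entry \<pi> 1 = v" "v = 1"
        using M entry_of_mem_pref_block by (blast, metis equals0I subsetD)
      then show False
        using not_one by simp
    qed
    then have "\<P> - {A} = pref_partition \<pi> - {?M, L}"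
      using red A_eq by auto
    then have "pref_partition \<pi> = insert L (insert ?M (\<P> - {A}))"
      using in_pp by auto
    moreover have "?M = A - L" "L \<subset> A"
      using A_eq disj_LM M by auto
    ultimately show ?rhs
      using one unfolding L by simp
  next
    assume rhs: ?rhs
    then have "L \<in> pref_partition \<pi>"
      by simp
    then obtain v where "L = pref_block \<pi> v"
      by (auto simp: pref_partition_def)
    then have L: "L = ?L"
      using rhs by (auto simp: pref_block_def)
    have "1 \<notin> ?M"
      using rhs by auto
    then have "entry \<pi> 1 \<noteq> 1"
      using n len by (auto simp: pref_block_def)
    moreover have "?M \<union> L = A"
      using rhs by auto
    moreover have "pref_partition \<pi> - {?M, L} = \<P> - {A}"
    proof -
      have "L \<notin> \<P> - {A}" "A - L \<notin> \<P> - {A}"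
        using rhs disj[of L A] disj[of "A - L" A] A by blast+
      then show ?thesis
        using rhs by auto
    qed
    ultimately have "reduced_pref_partition \<pi> = insert A (\<P> - {A})"
      using L by (simp add: reduced_pref_partition_def)
    then show ?lhs
      using A L \<open>entry \<pi> 1 \<noteq> 1\<close> by auto
  }
qed

lemma partition_on_split_block:
  assumes "partition_on X \<P>" "A \<in> \<P>" "L \<subset> A" "L \<noteq> {}" "finite X"
  shows "partition_on X (insert L (insert (A - L) (\<P> - {A})))"
    and "card (insert L (insert (A - L) (\<P> - {A}))) = Suc (card \<P>)"
proof -
  have union: "\<Union>\<P> = X" and ne: "{} \<notin> \<P>"
    and disj: "\<And>B C. B \<in> \<P> \<Longrightarrow> C \<in> \<P> \<Longrightarrow> B \<noteq> C \<Longrightarrow> B \<inter> C = {}"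
    using assms(1) by (auto simp: partition_on_def disjoint_def)
  have rest: "A \<inter> B = {}" if "B \<in> \<P> - {A}" for B
    using that disj[of A B] assms(2) by auto
  show "partition_on X (insert L (insert (A - L) (\<P> - {A})))"
  proof (rule partition_onI)
    show "\<Union>(insert L (insert (A - L) (\<P> - {A}))) = X"
      using union assms by blast
    show "{} \<notin> insert L (insert (A - L) (\<P> - {A}))"
      using ne assms by auto
    fix p q assume "p \<in> insert L (insert (A - L) (\<P> - {A}))"
      "q \<in> insert L (insert (A - L) (\<P> - {A}))" "p \<noteq> q"
    then show "disjnt p q"
      using rest disj[of p q] assms(3) unfolding disjnt_def by blast
  qed
  have "finite \<P>"
    using union assms by (metis finite_UnionD)
  moreover have "L \<notin> \<P> - {A}" "A - L \<notin> \<P> - {A}" "L \<noteq> A - L"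
    using rest[of L] rest[of "A - L"] assms by blast+
  ultimately show "card (insert L (insert (A - L) (\<P> - {A}))) = Suc (card \<P>)"
    using card_Suc_Diff1[of \<P> A] assms(2) by simp
qed

section \<open>The joint distribution\<close>

lemma card_subsets_containing:
  assumes "finite A" "a \<in> A"
  shows "card {L. a \<in> L \<and> L \<subseteq> A \<and> card L = Suc k} = (card A - 1) choose k"
proof -
  have "bij_betw (insert a) {L. L \<subseteq> A - {a} \<and> card L = k} {L. a \<in> L \<and> L \<subseteq> A \<and> card L = Suc k}"
  proof (rule bij_betw_byWitness[where f' = "\<lambda>L. L - {a}"])
    show "insert a ` {L. L \<subseteq> A - {a} \<and> card L = k} \<subseteq> {L. a \<in> L \<and> L \<subseteq> A \<and> card L = Suc k}"
    proof safe
      fix L assume "L \<subseteq> A - {a}"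
      then have "finite L" "a \<notin> L"
        using assms(1) by (auto intro: finite_subset)
      then show "card (insert a L) = Suc (card L)"
        by simp
    qed (use assms in auto)
    show "(\<lambda>L. L - {a}) ` {L. a \<in> L \<and> L \<subseteq> A \<and> card L = Suc k} \<subseteq> {L. L \<subseteq> A - {a} \<and> card L = k}"
      by auto
  qed auto
  then have "card {L. a \<in> L \<and> L \<subseteq> A \<and> card L = Suc k} = card {L. L \<subseteq> A - {a} \<and> card L = k}"
    by (rule bij_betw_same_card[symmetric])
  also have "\<dots> = (card A - 1) choose k"
    using assms by (simp add: n_subsets)
  finally show ?thesis .
qed

text \<open>
  The sets counted are split according to \<open>L = B\<^sub>\<pi>(\<pi>\<^sub>1)\<close>. By \<open>card_PF_blocks\<close> all parts have the
  same size, because every refinement of \<open>\<P>\<close> by a split of \<open>A\<close> has one more block than \<open>\<P>\<close>. The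
  hypothesis \<open>l \<noteq> m\<close> is what excludes \<open>\<pi>\<^sub>1 = 1\<close>.
\<close>

lemma card_PF_lel_ones:
  assumes b: "b \<ge> 1" and n: "n \<ge> 1" and \<P>: "partition_on {1..n} \<P>" and A: "A \<in> \<P>" "1 \<in> A"
    and "l \<noteq> m" and lm: "Suc l + Suc m = card A"
  shows "n * card {\<pi> \<in> PF 1 b n. reduced_pref_partition \<pi> = \<P> \<and> lel \<pi> = Suc l \<and> ones \<pi> = Suc m}
       = ((card A - 1) choose l) * Suc m * (\<Prod>k=0..<card \<P>. n * b - k)"
proof -
  define X where "X = {\<pi> \<in> PF 1 b n. reduced_pref_partition \<pi> = \<P> \<and> lel \<pi> = Suc l \<and> ones \<pi> = Suc m}"
  define \<L> where "\<L> = {L. 1 \<in> L \<and> L \<subseteq> A \<and> card L = Suc l}"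
  have "A \<subseteq> {1..n}"
    using \<P> A by (auto simp: partition_on_def)
  then have finA: "finite A"
    by (rule finite_subset) simp
  have finL: "finite \<L>"
    by (rule finite_subset[of _ "Pow A"]) (use finA in \<open>auto simp: \<L>_def\<close>)
  have stats: "lel \<pi> = card (pref_block \<pi> (entry \<pi> 1))" "ones \<pi> = card (pref_block \<pi> 1)" for \<pi>
    by (simp_all add: lel_def ones_def pref_block_def)
  have fibre: "{\<pi> \<in> X. pref_block \<pi> (entry \<pi> 1) = L} =
      {\<pi> \<in> PF 1 b n. pref_partition \<pi> = insert L (insert (A - L) (\<P> - {A})) \<and> pref_block \<pi> 1 = A - L}"
    and M: "card (A - L) = Suc m" and proper: "1 \<in> L" "L \<subset> A"
    if L: "L \<in> \<L>" for L
  proof -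
    show proper: "1 \<in> L" "L \<subset> A"
      using L lm by (auto simp: \<L>_def)
    show M: "card (A - L) = Suc m"
      using L lm card_Diff_subset[of L A] finite_subset[of L A] finA by (simp add: \<L>_def)
    have "\<pi> \<in> X \<and> pref_block \<pi> (entry \<pi> 1) = L \<longleftrightarrow>
        pref_partition \<pi> = insert L (insert (A - L) (\<P> - {A})) \<and> pref_block \<pi> 1 = A - L"
      if "\<pi> \<in> PF 1 b n" for \<pi>
    proof -
      note iff = PF_reduced_split_iff[OF n \<P> A that, of L]
      show ?thesis
      proof
        assume X: "\<pi> \<in> X \<and> pref_block \<pi> (entry \<pi> 1) = L"
        then have "lel \<pi> = Suc l" "ones \<pi> = Suc m"
          by (simp_all add: X_def)
        then have "card (pref_block \<pi> (entry \<pi> 1)) \<noteq> card (pref_block \<pi> 1)"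
          using \<open>l \<noteq> m\<close> by (simp add: stats)
        then have "entry \<pi> 1 \<noteq> 1"
          by metis
        then show "pref_partition \<pi> = insert L (insert (A - L) (\<P> - {A})) \<and> pref_block \<pi> 1 = A - L"
          using iff X unfolding X_def by blast
      next
        assume rhs: "pref_partition \<pi> = insert L (insert (A - L) (\<P> - {A})) \<and> pref_block \<pi> 1 = A - L"
        then have "reduced_pref_partition \<pi> = \<P> \<and> entry \<pi> 1 \<noteq> 1 \<and> pref_block \<pi> (entry \<pi> 1) = L"
          using iff proper by blast
        moreover have "card L = Suc l"
          using L by (simp add: \<L>_def)
        ultimately show "\<pi> \<in> X \<and> pref_block \<pi> (entry \<pi> 1) = L"
          using rhs M that by (simp add: X_def stats)
      qed
    qed
    then show "{\<pi> \<in> X. pref_block \<pi> (entry \<pi> 1) = L} =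
      {\<pi> \<in> PF 1 b n. pref_partition \<pi> = insert L (insert (A - L) (\<P> - {A})) \<and> pref_block \<pi> 1 = A - L}"
      unfolding X_def by blast
  qed
  have "pref_block \<pi> (entry \<pi> 1) \<in> \<L>" if "\<pi> \<in> X" for \<pi>
  proof -
    have \<pi>: "\<pi> \<in> PF 1 b n" "reduced_pref_partition \<pi> = \<P>" and stats_\<pi>: "lel \<pi> = Suc l" "ones \<pi> = Suc m"
      using that by (simp_all add: X_def)
    then have "entry \<pi> 1 \<noteq> 1"
      using \<open>l \<noteq> m\<close> stats[of \<pi>] by auto
    then have "1 \<in> pref_block \<pi> (entry \<pi> 1)" "pref_block \<pi> (entry \<pi> 1) \<subset> A"
      using iffD1[OF PF_reduced_split_iff[OF n \<P> A \<pi>(1)], OF conjI[OF \<pi>(2) conjI[OF _ refl]]]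
      by simp_all
    then show ?thesis
      using stats_\<pi> stats[of \<pi>] by (simp add: \<L>_def less_imp_le)
  qed
  moreover have "finite X"
    using finite_PF[of 1 b n] by (simp add: X_def)
  ultimately have "card X = (\<Sum>L\<in>\<L>. card {\<pi> \<in> X. pref_block \<pi> (entry \<pi> 1) = L})"
    using finL sum.group[of X \<L> "\<lambda>\<pi>. pref_block \<pi> (entry \<pi> 1)" "\<lambda>_. 1 :: nat"] by (simp add: image_subset_iff)
  also have "n * \<dots> = (\<Sum>L\<in>\<L>. Suc m * (\<Prod>k=0..<card \<P>. n * b - k))"
    unfolding sum_distrib_left
  proof (rule sum.cong)
    fix L assume L: "L \<in> \<L>"
    have "L \<noteq> {}"
      using proper[OF L] by auto
    note split = partition_on_split_block[OF \<P> A(1) proper(2)[OF L] this finite_atLeastAtMost]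
    show "n * card {\<pi> \<in> X. pref_block \<pi> (entry \<pi> 1) = L} = Suc m * (\<Prod>k=0..<card \<P>. n * b - k)"
      unfolding fibre[OF L] using card_PF_blocks[OF b split(1), of "A - L"] M[OF L] split(2) by simp
  qed simp
  also have "\<dots> = ((card A - 1) choose l) * Suc m * (\<Prod>k=0..<card \<P>. n * b - k)"
    using card_subsets_containing[OF finA A(2), of l] by (simp add: \<L>_def mult.assoc del: mult_Suc)
  finally show ?thesis
    by (simp add: X_def)
qed

text \<open>
  The pairs outside the range of \<open>card_PF_lel_ones\<close> are not attained off the diagonal.
\<close>

lemma PF_lel_ones_sum:
  assumes n: "n \<ge> 1" and \<P>: "partition_on {1..n} \<P>" and A: "A \<in> \<P>" "1 \<in> A"
    and \<pi>: "\<pi> \<in> PF 1 b n" "reduced_pref_partition \<pi> = \<P>" and "lel \<pi> \<noteq> ones \<pi>"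
  shows "lel \<pi> \<ge> 1" "ones \<pi> \<ge> 1" "lel \<pi> + ones \<pi> = card A"
proof -
  let ?L = "pref_block \<pi> (entry \<pi> 1)"
  have stats: "lel \<pi> = card ?L" "ones \<pi> = card (pref_block \<pi> 1)"
    by (simp_all add: lel_def ones_def pref_block_def)
  have not_one: "entry \<pi> 1 \<noteq> 1"
    using \<open>lel \<pi> \<noteq> ones \<pi>\<close> unfolding stats by metis
  note iff = PF_reduced_split_iff[OF n \<P> A \<pi>(1), of ?L]
  note rhs = iffD1[OF iff, OF conjI[OF \<pi>(2) conjI[OF not_one refl]]]
  have split: "1 \<in> ?L" "?L \<subset> A" "pref_block \<pi> 1 = A - ?L"
    by (rule rhs[THEN conjunct1], rule rhs[THEN conjunct2, THEN conjunct1],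
        rule rhs[THEN conjunct2, THEN conjunct2, THEN conjunct2])
  have fin: "finite (pref_block \<pi> v)" for v
    by (simp add: pref_block_def)
  show "lel \<pi> \<ge> 1" "ones \<pi> \<ge> 1"
    using split(1) PF_ones_block_nonempty[OF n \<pi>(1)] fin
    by (auto simp: stats Suc_le_eq card_gt_0_iff)
  have "A = ?L \<union> pref_block \<pi> 1"
    using split by auto
  then show "lel \<pi> + ones \<pi> = card A"
    using card_Un_disjoint[OF fin fin, of "entry \<pi> 1" 1] pref_block_disjoint[OF not_one]
    by (simp add: stats)
qed

theorem corollary8p1:
  fixes b n :: nat and \<P> :: "nat set set" and i j :: int
  assumes "b \<ge> 1" and "n \<ge> 1"
    and "partition_on {1..n} \<P>"
  shows "card {\<pi> \<in> PF 1 b n. reduced_pref_partition \<pi> = \<P> \<and>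
                  (int (lel \<pi>), int (ones \<pi>)) = (i, j)}
       = card {\<pi> \<in> PF 1 b n. reduced_pref_partition \<pi> = \<P> \<and>
                  (int (lel \<pi>), int (ones \<pi>)) = (j, i)}"
    (is "card (?X i j) = card (?X j i)")
proof (cases "i = j")
  case False
  have "1 \<in> \<Union>\<P>"
    unfolding partition_onD1[OF assms(3), symmetric] using assms(2) by simp
  then obtain A where A: "A \<in> \<P>" "1 \<in> A"
    by blast
  note sum = PF_lel_ones_sum[OF assms(2,3) A]
  show ?thesis
  proof (cases "i \<ge> 1 \<and> j \<ge> 1 \<and> i + j = int (card A)")
    case True
    define l m where "l = nat (i - 1)" and "m = nat (j - 1)"
    have ij: "i = int (Suc l)" "j = int (Suc m)"
      using True by (simp_all add: l_def m_def)
    have lm: "l \<noteq> m" "Suc l + Suc m = card A"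
      using True False unfolding ij by auto
    have X: "?X (int p) (int q) =
        {\<pi> \<in> PF 1 b n. reduced_pref_partition \<pi> = \<P> \<and> lel \<pi> = p \<and> ones \<pi> = q}" for p q
      by auto
    have "n * card (?X i j) = ((card A - 1) choose l) * Suc m * (\<Prod>k=0..<card \<P>. n * b - k)"
      unfolding ij X using card_PF_lel_ones[OF assms A lm] .
    \<comment> \<open>Both sides are (l + m + 1)! / (l! m!).\<close>
    also have "((card A - 1) choose l) * Suc m = ((card A - 1) choose m) * Suc l"
    proof -
      have "card A - 1 = Suc (l + m)"
        using lm by simp
      moreover have "Suc (l + m) choose m = Suc (l + m) choose Suc l"
        by (subst binomial_symmetric) auto
      ultimately show ?thesis
        using Suc_times_binomial_add[of l m] by (simp add: mult.commute)
    qed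
    also have "((card A - 1) choose m) * Suc l * (\<Prod>k=0..<card \<P>. n * b - k) = n * card (?X j i)"
      unfolding ij X using card_PF_lel_ones[OF assms A, of m l] lm by simp
    finally show ?thesis
      using assms(2) by simp
  next
    case out: False
    have "?X p q = {}" if "{p, q} = {i, j}" for p q
    proof -
      have "p \<noteq> q" "\<not> (p \<ge> 1 \<and> q \<ge> 1 \<and> p + q = int (card A))"
        using that False out by (auto simp: doubleton_eq_iff)
      then show ?thesis
        using sum by fastforce
    qed
    then have "?X i j = {}" "?X j i = {}"
      by (simp_all only: insert_commute)
    then show ?thesis
      by (simp only:)
  qed
qed simp

end
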